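(* Let $\mathcal{L}\in\mathcal{M}(N)$, $\mathcal{T}\in\mathcal{A}(N)$, let $\mathbb{A}$ abstract $(\mathcal{L},\mathcal{T})$, let $(\mathcal{T},\mathbb{A})\models\mathsf{AxCmpl}$, and suppose $\mathbb{A}$ is finitary. For all states $p,q$ of $\mathcal{L}$, $p\sqsubseteq_{\mathcal{T}}q$ implies $p\sqsubseteq_{\mathbb{A}}q$.
   Context: $\mathsf{Act}$ countable set of visible actions, $\tau\notin\mathsf{Act}$, $\mathsf{L}=\mathsf{Act}\cup\{\tau\}$, involutive duality $\mu\mapsto\overline{\mu}$; $N\subseteq\mathsf{Act}$ non-blocking, $B=\mathsf{Act}\setminus N$; LTSs finite-image. Axioms (all $\alpha\in\mathsf{L}$, $\eta\in N$, $\mu\in\mathsf{Act}$, $\mu\ne\eta$): N-delay: $p_1\xrightarrow{\eta}p_2\xrightarrow{\alpha}p_3\Rightarrow\exists p_4.\,p_1\xrightarrow{\alpha}p_4\xrightarrow{\eta}p_3$; N-confluence: $p_1\xrightarrow{\eta}p_2,p_1\xrightarrow{\mu}p_3\Rightarrow\exists p_4.\,p_2\xrightarrow{\mu}p_4,p_3\xrightarrow{\eta}p_4$; N-determinacy: $p_1\xrightarrow{\eta}p_2,p_1\xrightarrow{\eta}p_3\Rightarrow p_2=p_3$; backwards-N-determinacy: $p_2\xrightarrow{\eta}p_1,p_3\xrightarrow{\eta}p_1\Rightarrow p_2=p_3$; Fwd-Feedback: $p_1\xrightarrow{\eta}p_2\xrightarrow{\overline{\eta}}p_3\Rightarrow p_1\xrightarrow{\tau}p_3$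 or $p_1=p_3$; Boomerang: each $p$ has $p'$ with $p\xrightarrow{\overline{\eta}}p'\xrightarrow{\eta}p$; N-tau: $p_1\xrightarrow{\eta}p_2,p_1\xrightarrow{\tau}p_3$ imply $\exists p_4.\,p_2\xrightarrow{\tau}p_4,p_3\xrightarrow{\eta}p_4$, or $p_2\xrightarrow{\overline{\eta}}p_3$; Feedback: $p\xrightarrow{\eta}q\xrightarrow{\overline{\eta}}q'\Rightarrow p\xrightarrow{\tau}q'$. $\mathcal{M}(N)$: LTSs with N-delay, N-confluence, N-determinacy, backwards-N-determinacy, Fwd-Feedback, Boomerang, N-tau. $\mathcal{A}(N)$: LTSs with N-delay, N-confluence, N-determinacy, backwards-N-determinacy, N-tau, Feedback. Composition of $p$ and test $t$: steps by $\tau$-moves of either side or by $p\xrightarrow{\overline{\mu}}p'$, $t\xrightarrow{\mu}t'$. good: decidable predicate on tests preserved in both directions by $N$-transitions. Must$(p,t)$ iff every maximal computation from $(p,t)$ contains a state with good test; $p\sqsubseteq_{\mathcal{T}}q$ iff for all tests $t$, Must$(p,t)\Rightarrow$Must$(q,t)$. $p\Downarrow s$: no state reached via a weak transition along a prefix of $s$ has an infinite $\tau$-sequence. $\mathrm{ws}(p,s)=\{q:p\overset{s}{\Rightarrow}q\not\xrightarrow{\tau}\}$. $R(t)=\{\mu:t\xrightarrow{\mu}\}$, $\mathrm{coR}(p)=\{\beta\in B:p\xrightarrow{\overline{\beta}}\}$. Label abstraction $\mathbb{A}=(\phi:B\to Y,\delta:Y\to X)$, $\mathrm{coR}_{\mathbb{A}}(p)=\{\delta(\phi(\beta)):\beta\in\mathrm{coR}(p)\}$;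 finitary if all $\mathrm{coR}_{\mathbb{A}}(p)$ are finite; abstracts $(\mathcal{L},\mathcal{T})$ if for all $\beta,\beta'\in B$: (i) for each test $t$, $\phi(\beta)=\phi(\beta')$, $\beta\in R(t)\Rightarrow\beta'\in R(t)$; (ii) for each $p$ in $\mathcal{L}$, $\delta(\phi(\beta))=\delta(\phi(\beta'))$, $\phi(\beta)\in\phi(\mathrm{coR}(p))\Rightarrow\phi(\beta')\in\phi(\mathrm{coR}(p))$. $[\![p]\!](s)=\{\mathrm{coR}_{\mathbb{A}}(q):q\in\mathrm{ws}(p,s)\}$; $\mathcal{A}\ll\mathcal{B}$ iff each $x\in\mathcal{B}$ has $y\in\mathcal{A}$ with $y\subseteq x$; $p\sqsubseteq_{\mathbb{A}}q$ iff for all $s\in\mathsf{Act}^*$, $p\Downarrow s$ implies $q\Downarrow s$ and $[\![p]\!](s)\ll[\![q]\!](s)$. $(\mathcal{T},\mathbb{A})\models\mathsf{AxCmpl}$: there are $t_{cnv}:\mathsf{Act}^*\to T$, $t_{acc}:\mathsf{Act}^*\times\mathcal{P}_{fin}(X)\to T$ such that for all $s$, $\mu,\mu'\in\mathsf{Act}$, finite $E\subseteq X$, $f\in\{t_{cnv},t_{acc}(\cdot,E)\}$: (1) not good$(f(s))$; (2) $f(\mu.s)\xrightarrow{\mu}f(s)$; (3) $\mu\in B\Rightarrow f(\mu.s)\xrightarrow{\tau}$; (4) $\mu\in B$, $f(\mu.s)\xrightarrow{\tau}t\Rightarrow$ good$(t)$; (5) $\mu\in B$, $f(\mu.s)\xrightarrow{\mu}t\Rightarrow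 t=f(s)$; (6) $\mu\in B$, $f(\mu.s)\xrightarrow{\mu'}t$, $\mu'\ne\mu\Rightarrow$ good$(t)$; (a1) $t_{acc}(\varepsilon,E)\not\xrightarrow{\tau}$; (a2) $t_{acc}(\varepsilon,E)\not\xrightarrow{\eta}$, $\eta\in N$; (a3) $\beta\in B$, $t_{acc}(\varepsilon,E)\xrightarrow{\beta}\Rightarrow\delta(\phi(\beta))\in E$; (a4) each $e\in E$ is $\delta(\phi(\beta))$ for some $\beta\in B$ with $t_{acc}(\varepsilon,E)\xrightarrow{\beta}$; (a5) $\beta\in B$, $t_{acc}(\varepsilon,E)\xrightarrow{\beta}t\Rightarrow$ good$(t)$; (c1) $t_{cnv}(\varepsilon)\not\xrightarrow{\mu}$, $\mu\in\mathsf{Act}$; (c2) $t_{cnv}(\varepsilon)\xrightarrow{\tau}$; (c3) $t_{cnv}(\varepsilon)\xrightarrow{\tau}t\Rightarrow$ good$(t)$. *)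

theory Defs
  imports "HOL-Library.Countable" "HOL-Library.FuncSet" "HOL-Library.Sublist"
begin

datatype 'a label = Tau | Vis 'a

type_synonym ('s, 'a) lts = "'s \<Rightarrow> 'a label \<Rightarrow> 's \<Rightarrow> bool"

definition involutive :: "('a \<Rightarrow> 'a) \<Rightarrow> bool" where
  "involutive dual \<longleftrightarrow> (\<forall>\<mu>. dual (dual \<mu>) = \<mu>)"

definition enabled :: "('s, 'a) lts \<Rightarrow> 's \<Rightarrow> 'a label \<Rightarrow> bool" where
  "enabled R p \<alpha> \<longleftrightarrow> (\<exists>p'. R p \<alpha> p')"

definition finite_image :: "('s, 'a) lts \<Rightarrow> bool" where
  "finite_image R \<longleftrightarrow> (\<forall>p \<alpha>. finite {p'. R p \<alpha> p'})"

subsection \<open>Axioms on labelled transition systems\<close>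

text \<open>\<open>N\<close> is the set of non-blocking actions; the blocking actions are its complement \<open>- N\<close>.\<close>

definition N_delay :: "'a set \<Rightarrow> ('s, 'a) lts \<Rightarrow> bool" where
  "N_delay N R \<longleftrightarrow> (\<forall>\<eta>\<in>N. \<forall>\<alpha> p1 p2 p3. R p1 (Vis \<eta>) p2 \<longrightarrow> R p2 \<alpha> p3 \<longrightarrow>
     (\<exists>p4. R p1 \<alpha> p4 \<and> R p4 (Vis \<eta>) p3))"

definition N_confluence :: "'a set \<Rightarrow> ('s, 'a) lts \<Rightarrow> bool" where
  "N_confluence N R \<longleftrightarrow> (\<forall>\<eta>\<in>N. \<forall>\<mu> p1 p2 p3. \<mu> \<noteq> \<eta> \<longrightarrow> R p1 (Vis \<eta>) p2 \<longrightarrow> R p1 (Vis \<mu>) p3 \<longrightarrow>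
     (\<exists>p4. R p2 (Vis \<mu>) p4 \<and> R p3 (Vis \<eta>) p4))"

definition N_determinacy :: "'a set \<Rightarrow> ('s, 'a) lts \<Rightarrow> bool" where
  "N_determinacy N R \<longleftrightarrow>
     (\<forall>\<eta>\<in>N. \<forall>p1 p2 p3. R p1 (Vis \<eta>) p2 \<longrightarrow> R p1 (Vis \<eta>) p3 \<longrightarrow> p2 = p3)"

definition backwards_N_determinacy :: "'a set \<Rightarrow> ('s, 'a) lts \<Rightarrow> bool" where
  "backwards_N_determinacy N R \<longleftrightarrow>
     (\<forall>\<eta>\<in>N. \<forall>p1 p2 p3. R p2 (Vis \<eta>) p1 \<longrightarrow> R p3 (Vis \<eta>) p1 \<longrightarrow> p2 = p3)"

definition Fwd_Feedback :: "('a \<Rightarrow> 'a) \<Rightarrow> 'a set \<Rightarrow> ('s, 'a) lts \<Rightarrow> bool" where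
  "Fwd_Feedback dual N R \<longleftrightarrow>
     (\<forall>\<eta>\<in>N. \<forall>p1 p2 p3. R p1 (Vis \<eta>) p2 \<longrightarrow> R p2 (Vis (dual \<eta>)) p3 \<longrightarrow> R p1 Tau p3 \<or> p1 = p3)"

definition Boomerang :: "('a \<Rightarrow> 'a) \<Rightarrow> 'a set \<Rightarrow> ('s, 'a) lts \<Rightarrow> bool" where
  "Boomerang dual N R \<longleftrightarrow> (\<forall>\<eta>\<in>N. \<forall>p. \<exists>p'. R p (Vis (dual \<eta>)) p' \<and> R p' (Vis \<eta>) p)"

definition N_tau :: "('a \<Rightarrow> 'a) \<Rightarrow> 'a set \<Rightarrow> ('s, 'a) lts \<Rightarrow> bool" where
  "N_tau dual N R \<longleftrightarrow> (\<forall>\<eta>\<in>N. \<forall>p1 p2 p3. R p1 (Vis \<eta>) p2 \<longrightarrow> R p1 Tau p3 \<longrightarrow>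
     (\<exists>p4. R p2 Tau p4 \<and> R p3 (Vis \<eta>) p4) \<or> R p2 (Vis (dual \<eta>)) p3)"

definition Feedback :: "('a \<Rightarrow> 'a) \<Rightarrow> 'a set \<Rightarrow> ('s, 'a) lts \<Rightarrow> bool" where
  "Feedback dual N R \<longleftrightarrow>
     (\<forall>\<eta>\<in>N. \<forall>p q q'. R p (Vis \<eta>) q \<longrightarrow> R q (Vis (dual \<eta>)) q' \<longrightarrow> R p Tau q')"

definition in_M :: "('a \<Rightarrow> 'a) \<Rightarrow> 'a set \<Rightarrow> ('s, 'a) lts \<Rightarrow> bool" where
  "in_M dual N R \<longleftrightarrow> N_delay N R \<and> N_confluence N R \<and> N_determinacy N R \<and>
     backwards_N_determinacy N R \<and> Fwd_Feedback dual N R \<and> Boomerang dual N R \<and> N_tau dual N R"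

definition in_A :: "('a \<Rightarrow> 'a) \<Rightarrow> 'a set \<Rightarrow> ('s, 'a) lts \<Rightarrow> bool" where
  "in_A dual N R \<longleftrightarrow> N_delay N R \<and> N_confluence N R \<and> N_determinacy N R \<and>
     backwards_N_determinacy N R \<and> N_tau dual N R \<and> Feedback dual N R"

subsection \<open>Must-testing\<close>

inductive comp_step ::
    "('a \<Rightarrow> 'a) \<Rightarrow> ('p, 'a) lts \<Rightarrow> ('t, 'a) lts \<Rightarrow> 'p \<times> 't \<Rightarrow> 'p \<times> 't \<Rightarrow> bool"
  for dual :: "'a \<Rightarrow> 'a" and L :: "('p, 'a) lts" and T :: "('t, 'a) lts" where
  proc_tau: "L p Tau p' \<Longrightarrow> comp_step dual L T (p, t) (p', t)"
| test_tau: "T t Tau t' \<Longrightarrow> comp_step dual L T (p, t) (p, t')"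
| comm: "L p (Vis (dual \<mu>)) p' \<Longrightarrow> T t (Vis \<mu>) t' \<Longrightarrow> comp_step dual L T (p, t) (p', t')"

definition finite_maximal_computation :: "('s \<Rightarrow> 's \<Rightarrow> bool) \<Rightarrow> 's \<Rightarrow> 's list \<Rightarrow> bool" where
  "finite_maximal_computation step x xs \<longleftrightarrow>
     xs \<noteq> [] \<and> hd xs = x \<and> successively step xs \<and> (\<nexists>y. step (last xs) y)"

definition infinite_computation :: "('s \<Rightarrow> 's \<Rightarrow> bool) \<Rightarrow> 's \<Rightarrow> (nat \<Rightarrow> 's) \<Rightarrow> bool" where
  "infinite_computation step x c \<longleftrightarrow> c 0 = x \<and> (\<forall>i. step (c i) (c (Suc i)))"

text \<open>A maximal computation is either infinite or finite with a stuck last state.\<close>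

definition Must ::
    "('a \<Rightarrow> 'a) \<Rightarrow> ('p, 'a) lts \<Rightarrow> ('t, 'a) lts \<Rightarrow> ('t \<Rightarrow> bool) \<Rightarrow> 'p \<Rightarrow> 't \<Rightarrow> bool" where
  "Must dual L T good p t \<longleftrightarrow>
     (\<forall>xs. finite_maximal_computation (comp_step dual L T) (p, t) xs \<longrightarrow> (\<exists>x\<in>set xs. good (snd x))) \<and>
     (\<forall>c. infinite_computation (comp_step dual L T) (p, t) c \<longrightarrow> (\<exists>i. good (snd (c i))))"

definition must_preorder ::
    "('a \<Rightarrow> 'a) \<Rightarrow> ('p, 'a) lts \<Rightarrow> ('t, 'a) lts \<Rightarrow> ('t \<Rightarrow> bool) \<Rightarrow> 'p \<Rightarrow> 'p \<Rightarrow> bool" where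
  "must_preorder dual L T good p q \<longleftrightarrow>
     (\<forall>t. Must dual L T good p t \<longrightarrow> Must dual L T good q t)"

definition good_N_invariant :: "'a set \<Rightarrow> ('t, 'a) lts \<Rightarrow> ('t \<Rightarrow> bool) \<Rightarrow> bool" where
  "good_N_invariant N T good \<longleftrightarrow> (\<forall>\<eta>\<in>N. \<forall>t t'. T t (Vis \<eta>) t' \<longrightarrow> (good t \<longleftrightarrow> good t'))"

subsection \<open>Weak transitions, convergence and label abstractions\<close>

inductive weak :: "('s, 'a) lts \<Rightarrow> 's \<Rightarrow> 'a list \<Rightarrow> 's \<Rightarrow> bool"
  for R :: "('s, 'a) lts" where
  weak_refl: "weak R p [] p"
| weak_tau: "R p Tau p' \<Longrightarrow> weak R p' s q \<Longrightarrow> weak R p s q"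
| weak_vis: "R p (Vis \<mu>) p' \<Longrightarrow> weak R p' s q \<Longrightarrow> weak R p (\<mu> # s) q"

definition diverges :: "('s, 'a) lts \<Rightarrow> 's \<Rightarrow> bool" where
  "diverges R p \<longleftrightarrow> (\<exists>c. infinite_computation (\<lambda>x y. R x Tau y) p c)"

definition converges_along :: "('s, 'a) lts \<Rightarrow> 's \<Rightarrow> 'a list \<Rightarrow> bool" where
  "converges_along R p s \<longleftrightarrow> (\<forall>s' q. prefix s' s \<longrightarrow> weak R p s' q \<longrightarrow> \<not> diverges R q)"

definition ws :: "('s, 'a) lts \<Rightarrow> 's \<Rightarrow> 'a list \<Rightarrow> 's set" where
  "ws R p s = {q. weak R p s q \<and> \<not> enabled R q Tau}"

definition ready :: "('s, 'a) lts \<Rightarrow> 's \<Rightarrow> 'a set" where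
  "ready R t = {\<mu>. enabled R t (Vis \<mu>)}"

definition coR :: "('a \<Rightarrow> 'a) \<Rightarrow> 'a set \<Rightarrow> ('s, 'a) lts \<Rightarrow> 's \<Rightarrow> 'a set" where
  "coR dual N R p = {\<beta> \<in> - N. enabled R p (Vis (dual \<beta>))}"

text \<open>The values of \<open>\<phi>\<close> outside \<open>- N\<close> and of \<open>\<delta>\<close> outside \<open>Y\<close> are irrelevant.\<close>

definition label_abstraction ::
    "'a set \<Rightarrow> 'y set \<Rightarrow> 'x set \<Rightarrow> ('a \<Rightarrow> 'y) \<Rightarrow> ('y \<Rightarrow> 'x) \<Rightarrow> bool" where
  "label_abstraction N Y X \<phi> \<delta> \<longleftrightarrow> \<phi> \<in> - N \<rightarrow> Y \<and> \<delta> \<in> Y \<rightarrow> X"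

definition coR_abs ::
    "('a \<Rightarrow> 'a) \<Rightarrow> 'a set \<Rightarrow> ('s, 'a) lts \<Rightarrow> ('a \<Rightarrow> 'y) \<Rightarrow> ('y \<Rightarrow> 'x) \<Rightarrow> 's \<Rightarrow> 'x set" where
  "coR_abs dual N R \<phi> \<delta> p = (\<lambda>\<beta>. \<delta> (\<phi> \<beta>)) ` coR dual N R p"

definition finitary ::
    "('a \<Rightarrow> 'a) \<Rightarrow> 'a set \<Rightarrow> ('s, 'a) lts \<Rightarrow> ('a \<Rightarrow> 'y) \<Rightarrow> ('y \<Rightarrow> 'x) \<Rightarrow> bool" where
  "finitary dual N R \<phi> \<delta> \<longleftrightarrow> (\<forall>p. finite (coR_abs dual N R \<phi> \<delta> p))"

definition abstracts ::
    "('a \<Rightarrow> 'a) \<Rightarrow> 'a set \<Rightarrow> ('a \<Rightarrow> 'y) \<Rightarrow> ('y \<Rightarrow> 'x) \<Rightarrow> ('p, 'a) lts \<Rightarrow> ('t, 'a) lts \<Rightarrow> bool" where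
  "abstracts dual N \<phi> \<delta> L T \<longleftrightarrow> (\<forall>\<beta>\<in>- N. \<forall>\<beta>'\<in>- N.
     (\<forall>t. \<phi> \<beta> = \<phi> \<beta>' \<longrightarrow> \<beta> \<in> ready T t \<longrightarrow> \<beta>' \<in> ready T t) \<and>
     (\<forall>p. \<delta> (\<phi> \<beta>) = \<delta> (\<phi> \<beta>') \<longrightarrow> \<phi> \<beta> \<in> \<phi> ` coR dual N L p \<longrightarrow> \<phi> \<beta>' \<in> \<phi> ` coR dual N L p))"

definition acc_sets ::
    "('a \<Rightarrow> 'a) \<Rightarrow> 'a set \<Rightarrow> ('s, 'a) lts \<Rightarrow> ('a \<Rightarrow> 'y) \<Rightarrow> ('y \<Rightarrow> 'x) \<Rightarrow> 's \<Rightarrow> 'a list \<Rightarrow> 'x set set"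
  where "acc_sets dual N R \<phi> \<delta> p s = coR_abs dual N R \<phi> \<delta> ` ws R p s"

definition acc_le :: "'x set set \<Rightarrow> 'x set set \<Rightarrow> bool" where
  "acc_le U V \<longleftrightarrow> (\<forall>x\<in>V. \<exists>y\<in>U. y \<subseteq> x)"

definition abs_preorder ::
    "('a \<Rightarrow> 'a) \<Rightarrow> 'a set \<Rightarrow> ('s, 'a) lts \<Rightarrow> ('a \<Rightarrow> 'y) \<Rightarrow> ('y \<Rightarrow> 'x) \<Rightarrow> 's \<Rightarrow> 's \<Rightarrow> bool" where
  "abs_preorder dual N R \<phi> \<delta> p q \<longleftrightarrow> (\<forall>s. converges_along R p s \<longrightarrow>
     converges_along R q s \<and> acc_le (acc_sets dual N R \<phi> \<delta> p s) (acc_sets dual N R \<phi> \<delta> q s))"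

subsection \<open>Test generators for completeness\<close>

definition trace_following ::
    "'a set \<Rightarrow> ('t, 'a) lts \<Rightarrow> ('t \<Rightarrow> bool) \<Rightarrow> ('a list \<Rightarrow> 't) \<Rightarrow> bool" where
  "trace_following N T good f \<longleftrightarrow> (\<forall>s.
     \<not> good (f s) \<and>
     (\<forall>\<mu>. T (f (\<mu> # s)) (Vis \<mu>) (f s)) \<and>
     (\<forall>\<mu>\<in>- N. enabled T (f (\<mu> # s)) Tau) \<and>
     (\<forall>\<mu>\<in>- N. \<forall>t. T (f (\<mu> # s)) Tau t \<longrightarrow> good t) \<and>
     (\<forall>\<mu>\<in>- N. \<forall>t. T (f (\<mu> # s)) (Vis \<mu>) t \<longrightarrow> t = f s) \<and>
     (\<forall>\<mu>\<in>- N. \<forall>\<mu>' t. T (f (\<mu> # s)) (Vis \<mu>') t \<longrightarrow> \<mu>' \<noteq> \<mu> \<longrightarrow> good t))"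

definition AxCmpl ::
    "'a set \<Rightarrow> ('t, 'a) lts \<Rightarrow> ('t \<Rightarrow> bool) \<Rightarrow> 'x set \<Rightarrow> ('a \<Rightarrow> 'y) \<Rightarrow> ('y \<Rightarrow> 'x) \<Rightarrow> bool" where
  "AxCmpl N T good X \<phi> \<delta> \<longleftrightarrow> (\<exists>(tcnv :: 'a list \<Rightarrow> 't) (tacc :: 'a list \<Rightarrow> 'x set \<Rightarrow> 't).
     trace_following N T good tcnv \<and>
     (\<forall>E. finite E \<longrightarrow> E \<subseteq> X \<longrightarrow>
        trace_following N T good (\<lambda>s. tacc s E) \<and>
        \<not> enabled T (tacc [] E) Tau \<and>
        (\<forall>\<eta>\<in>N. \<not> enabled T (tacc [] E) (Vis \<eta>)) \<and>
        (\<forall>\<beta>\<in>- N. enabled T (tacc [] E) (Vis \<beta>) \<longrightarrow> \<delta> (\<phi> \<beta>) \<in> E) \<and>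
        (\<forall>e\<in>E. \<exists>\<beta>\<in>- N. e = \<delta> (\<phi> \<beta>) \<and> enabled T (tacc [] E) (Vis \<beta>)) \<and>
        (\<forall>\<beta>\<in>- N. \<forall>t. T (tacc [] E) (Vis \<beta>) t \<longrightarrow> good t)) \<and>
     (\<forall>\<mu>. \<not> enabled T (tcnv []) (Vis \<mu>)) \<and>
     enabled T (tcnv []) Tau \<and>
     (\<forall>t. T (tcnv []) Tau t \<longrightarrow> good t))"

end

theory Submission
  imports Defs
begin

text \<open>
  A process \<open>p\<close> is run against the test \<open>f (map dual s)\<close>, where \<open>f\<close> is one of the two test
  generators. If \<open>p\<close> diverges along \<open>s\<close>, or reaches along \<open>s\<close> a stable state that cannot synchronise
  with \<open>f []\<close>, then test and process can walk along \<open>s\<close> through states that are not good, so \<open>Must\<close>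
  fails. Conversely, if \<open>p\<close> converges along \<open>s\<close>, passing \<open>f []\<close> after \<open>s\<close> suffices for passing
  \<open>f (map dual s)\<close>: a blocking head of the trace is handled by induction on the silent steps of \<open>p\<close>,
  while a non-blocking head \<open>\<eta>\<close> can be moved from the test into the process. So the convergence test
  of \<open>s\<close> decides convergence along \<open>s\<close>, and the acceptance test of \<open>s\<close> and \<open>E\<close> decides whether
  \<open>E\<close> hits every acceptance set after \<open>s\<close>. Finite hitting sets determine the preorder on acceptance
  sets: if no acceptance set of \<open>p\<close> is below the acceptance set \<open>x\<close> of \<open>q\<close>, then what the finitely
  many acceptance sets of \<open>p\<close> offer beyond \<open>x\<close> hits all of them, but not \<open>x\<close>.
\<close>

subsection \<open>Maximal computations and must-testing\<close>

lemma finite_maximal_computation_iff: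
  "finite_maximal_computation step x xs \<longleftrightarrow>
    xs = [x] \<and> (\<nexists>y. step x y) \<or>
    (\<exists>y ys. xs = x # ys \<and> step x y \<and> finite_maximal_computation step y ys)"
proof (cases xs)
  case (Cons z ys)
  then show ?thesis
    by (cases ys) (auto simp: finite_maximal_computation_def)
qed (simp add: finite_maximal_computation_def)

lemma infinite_computation_tail:
  assumes "infinite_computation step x c"
  shows "step x (c 1)" "infinite_computation step (c 1) (\<lambda>i. c (Suc i))"
  using assms by (auto simp: infinite_computation_def)

lemma infinite_computation_of_invariant:
  assumes "P x" and "\<And>y. P y \<Longrightarrow> \<exists>z. P z \<and> step y z"
  obtains c where "infinite_computation step x c" "\<And>i. P (c i)"
proof -
  obtain c where "\<And>n. P (c n) \<and> (n = 0 \<longrightarrow> c n = x)" "\<And>n. step (c n) (c (Suc n))"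
    using dependent_nat_choice[of "\<lambda>n y. P y \<and> (n = 0 \<longrightarrow> y = x)" "\<lambda>_. step"] assms
    by (metis nat.distinct(1))
  then show thesis
    using that[of c] by (simp add: infinite_computation_def)
qed

inductive inevitable :: "('s \<Rightarrow> 's \<Rightarrow> bool) \<Rightarrow> ('s \<Rightarrow> bool) \<Rightarrow> 's \<Rightarrow> bool"
  for step :: "'s \<Rightarrow> 's \<Rightarrow> bool" and G :: "'s \<Rightarrow> bool" where
  now: "G x \<Longrightarrow> inevitable step G x"
| later: "\<exists>y. step x y \<Longrightarrow> (\<And>y. step x y \<Longrightarrow> inevitable step G y) \<Longrightarrow> inevitable step G x"

lemma inevitable_finite_maximal_computation:
  assumes "inevitable step G x" "finite_maximal_computation step x xs"
  shows "\<exists>y\<in>set xs. G y"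
  using assms
proof (induction arbitrary: xs)
  case (now x)
  then show ?case
    by (auto simp: finite_maximal_computation_iff[of step x])
next
  case (later x)
  then obtain y ys where "xs = x # ys" "step x y" "finite_maximal_computation step y ys"
    using finite_maximal_computation_iff[of step x xs] by auto
  with later.IH show ?case
    by auto
qed

lemma inevitable_infinite_computation:
  assumes "inevitable step G x" "infinite_computation step x c"
  shows "\<exists>i. G (c i)"
  using assms
proof (induction arbitrary: c)
  case (now x)
  then show ?case
    by (metis infinite_computation_def)
next
  case (later x)
  then show ?case
    using infinite_computation_tail[OF later.prems] by blast
qed

lemma inevitableI_maximal_computations:
  assumes fin: "\<And>xs. finite_maximal_computation step x xs \<Longrightarrow> \<exists>y\<in>set xs. G y"
    and inf: "\<And>c. infinite_computation step x c \<Longrightarrow> \<exists>i. G (c i)"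
  shows "inevitable step G x"
proof (rule ccontr)
  define avoids where
    "avoids y xs \<longleftrightarrow> finite_maximal_computation step y xs \<and> (\<forall>z\<in>set xs. \<not> G z)" for y xs
  define bad where "bad y \<longleftrightarrow> \<not> inevitable step G y \<and> (\<nexists>xs. avoids y xs)" for y
  have bad_not_G: "\<not> G y" if "bad y" for y
    using that inevitable.now[of G y step] by (auto simp: bad_def)
  assume "\<not> inevitable step G x"
  with fin have "bad x"
    unfolding bad_def avoids_def by blast
  moreover have "\<exists>z. bad z \<and> step y z" if "bad y" for y
  proof -
    have "\<not> avoids y [y]"
      using that by (simp add: bad_def)
    then have "\<exists>z. step y z"
      using bad_not_G[OF that] by (auto simp: avoids_def finite_maximal_computation_iff[of step y])
    with that obtain z where z: "step y z" "\<not> inevitable step G z"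
      using inevitable.later[of step y G] by (auto simp: bad_def)
    have "avoids y (y # xs)" if "avoids z xs" for xs
      using that z(1) bad_not_G[OF \<open>bad y\<close>]
      by (auto simp: avoids_def finite_maximal_computation_iff[of step y])
    with that z show ?thesis
      by (auto simp: bad_def)
  qed
  ultimately obtain c where "infinite_computation step x c" "\<And>i. bad (c i)"
    using infinite_computation_of_invariant[of bad x step] by metis
  with inf bad_not_G show False
    by blast
qed

lemma Must_iff_inevitable:
  "Must dual L T good p t \<longleftrightarrow> inevitable (comp_step dual L T) (\<lambda>x. good (snd x)) (p, t)"
  using inevitable_finite_maximal_computation[of "comp_step dual L T" "\<lambda>x. good (snd x)" "(p, t)"]
    inevitable_infinite_computation[of "comp_step dual L T" "\<lambda>x. good (snd x)" "(p, t)"]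
    inevitableI_maximal_computations[of "comp_step dual L T" "(p, t)" "\<lambda>x. good (snd x)"]
  unfolding Must_def by blast

lemma Must_iff:
  "Must dual L T good p t \<longleftrightarrow> good t \<or> (\<exists>x. comp_step dual L T (p, t) x) \<and>
    (\<forall>p' t'. comp_step dual L T (p, t) (p', t') \<longrightarrow> Must dual L T good p' t')"
  unfolding Must_iff_inevitable
  by (subst inevitable.simps) auto

lemma Must_good: "good t \<Longrightarrow> Must dual L T good p t"
  by (subst Must_iff) simp

lemma Must_stepI:
  assumes "\<exists>x. comp_step dual L T (p, t) x"
    and "\<And>p'. L p Tau p' \<Longrightarrow> Must dual L T good p' t"
    and "\<And>t'. T t Tau t' \<Longrightarrow> Must dual L T good p t'"
    and "\<And>\<mu> p' t'. L p (Vis (dual \<mu>)) p' \<Longrightarrow> T t (Vis \<mu>) t' \<Longrightarrow> Must dual L T good p' t'"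
  shows "Must dual L T good p t"
  using assms by (subst Must_iff) (auto elim: comp_step.cases)

lemma Must_comp_step:
  assumes "Must dual L T good p t" "\<not> good t" "comp_step dual L T (p, t) (p', t')"
  shows "Must dual L T good p' t'"
  using assms by (subst (asm) Must_iff) blast

lemma Must_not_stuck:
  assumes "Must dual L T good p t" "\<not> good t"
  shows "\<exists>x. comp_step dual L T (p, t) x"
  using assms by (subst (asm) Must_iff) blast

lemma Must_induct [consumes 1, case_names good step]:
  assumes "Must dual L T good p t"
    and "\<And>p t. good t \<Longrightarrow> P p t"
    and "\<And>p t. Must dual L T good p t \<Longrightarrow>
      (\<And>p' t'. comp_step dual L T (p, t) (p', t') \<Longrightarrow> Must dual L T good p' t') \<Longrightarrow>
      (\<And>p' t'. comp_step dual L T (p, t) (p', t') \<Longrightarrow> P p' t') \<Longrightarrow> P p t"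
  shows "P p t"
  using assms(1) unfolding Must_iff_inevitable
proof (induction "(p, t)" arbitrary: p t)
  case now
  then show ?case
    using assms(2) by simp
next
  case later
  then show ?case
    using assms(3) inevitable.later[OF later.hyps(1,2)] by (simp add: Must_iff_inevitable)
qed

subsection \<open>Weak transitions and convergence\<close>

lemma not_diverges_induct [consumes 1, case_names step]:
  assumes "\<not> diverges R p"
    and "\<And>p. (\<And>p'. R p Tau p' \<Longrightarrow> P p') \<Longrightarrow> P p"
  shows "P p"
proof (rule ccontr)
  assume "\<not> P p"
  moreover have "\<exists>y. \<not> P y \<and> R x Tau y" if "\<not> P x" for x
    using assms(2) that by blast
  ultimately obtain c where "infinite_computation (\<lambda>x y. R x Tau y) p c"
    using infinite_computation_of_invariant[of "\<lambda>x. \<not> P x" p "\<lambda>x y. R x Tau y"] by metis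
  with assms(1) show False
    by (auto simp: diverges_def)
qed

lemma weak_append: "weak R p s q \<Longrightarrow> weak R q u r \<Longrightarrow> weak R p (s @ u) r"
  by (induction rule: weak.induct) (auto intro: weak.intros)

lemma weak_single_Tau: "R p Tau p' \<Longrightarrow> weak R p [] p'"
  by (blast intro: weak.intros)

lemma weak_single_Vis: "R p (Vis \<mu>) p' \<Longrightarrow> weak R p [\<mu>] p'"
  by (blast intro: weak.intros)

lemma ws_append: "weak R p s q \<Longrightarrow> ws R q u \<subseteq> ws R p (s @ u)"
  by (auto simp: ws_def intro: weak_append)

lemma converges_along_weak:
  assumes "converges_along R p (s @ u)" "weak R p s q"
  shows "converges_along R q u"
  using assms weak_append[of R p s q] unfolding converges_along_def by (metis same_prefix_prefix)

lemma converges_along_not_diverges: "converges_along R p s \<Longrightarrow> \<not> diverges R p"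
  unfolding converges_along_def by (metis Nil_prefix weak_refl)

lemma weak_derivative_not_diverges: "converges_along R p s \<Longrightarrow> weak R p s q \<Longrightarrow> \<not> diverges R q"
  unfolding converges_along_def by blast

lemma converges_along_induct [consumes 1, case_names Nil Cons]:
  assumes "converges_along R p s"
    and "\<And>p. (\<And>p'. R p Tau p' \<Longrightarrow> P p' []) \<Longrightarrow> P p []"
    and "\<And>p \<mu> s. (\<And>p'. R p Tau p' \<Longrightarrow> P p' (\<mu> # s)) \<Longrightarrow>
      (\<And>p'. R p (Vis \<mu>) p' \<Longrightarrow> P p' s) \<Longrightarrow> P p (\<mu> # s)"
  shows "P p s"
  using assms(1)
proof (induction s arbitrary: p)
  case Nil
  then have "\<not> diverges R p"
    by (rule converges_along_not_diverges)
  then show ?case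
    by (induction rule: not_diverges_induct) (rule assms(2))
next
  case (Cons \<mu> s)
  from converges_along_not_diverges[OF Cons.prems] Cons.prems show ?case
  proof (induction rule: not_diverges_induct)
    case (step p)
    have "P p' (\<mu> # s)" if "R p Tau p'" for p'
      using that step converges_along_weak[OF _ weak_single_Tau] by fastforce
    moreover have "P p' s" if "R p (Vis \<mu>) p'" for p'
      using that step.prems Cons.IH converges_along_weak[OF _ weak_single_Vis] by fastforce
    ultimately show ?case
      by (rule assms(3))
  qed
qed

lemma finite_weak_derivatives:
  assumes "finite_image R" and "converges_along R p s"
  shows "finite {q. weak R p s q}"
  using assms(2)
proof (induction rule: converges_along_induct)
  case (Nil p)
  have "{q. weak R p [] q} = insert p (\<Union>p'\<in>{p'. R p Tau p'}. {q. weak R p' [] q})"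
    by (auto intro: weak.intros elim: weak.cases)
  then show ?case
    using assms(1) Nil by (simp add: finite_image_def)
next
  case (Cons p \<mu> s)
  have "{q. weak R p (\<mu> # s) q} = (\<Union>p'\<in>{p'. R p Tau p'}. {q. weak R p' (\<mu> # s) q})
      \<union> (\<Union>p'\<in>{p'. R p (Vis \<mu>) p'}. {q. weak R p' s q})"
    by (auto intro: weak.intros elim: weak.cases)
  then show ?case
    using assms(1) Cons by (simp add: finite_image_def)
qed

subsection \<open>Must-testing along traces\<close>

lemma Must_not_diverges:
  assumes "Must dual L T good p t" "\<not> good t"
  shows "\<not> diverges L p"
proof
  assume "diverges L p"
  then obtain c where "infinite_computation (\<lambda>x y. L x Tau y) p c"
    by (auto simp: diverges_def)
  then have "infinite_computation (comp_step dual L T) (p, t) (\<lambda>i. (c i, t))"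
    by (auto simp: infinite_computation_def intro: comp_step.proc_tau)
  with assms show False
    unfolding Must_def by fastforce
qed

lemma Must_all_steps_good:
  assumes "\<not> diverges L p"
    and "\<And>\<alpha> t'. T t \<alpha> t' \<Longrightarrow> good t'"
    and "\<And>q. q \<in> ws L p [] \<Longrightarrow> \<exists>x. comp_step dual L T (q, t) x"
  shows "Must dual L T good p t"
  using assms(1,3)
proof (induction rule: not_diverges_induct)
  case (step p)
  show ?case
  proof (rule Must_stepI)
    show "\<exists>x. comp_step dual L T (p, t) x"
    proof (cases "enabled L p Tau")
      case True
      then show ?thesis
        by (auto simp: enabled_def intro: comp_step.proc_tau)
    next
      case False
      then show ?thesis
        using step.prems by (simp add: ws_def weak_refl)
    qed
  next
    fix p' assume "L p Tau p'"
    with step ws_append[OF weak_single_Tau] show "Must dual L T good p' t"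
      by fastforce
  qed (use assms(2) in \<open>blast intro: Must_good\<close>)+
qed

lemma trace_following_not_good: "trace_following N T good f \<Longrightarrow> \<not> good (f s)"
  by (simp add: trace_following_def)

lemma trace_following_Cons: "trace_following N T good f \<Longrightarrow> T (f (\<mu> # s)) (Vis \<mu>) (f s)"
  by (simp add: trace_following_def)

lemma Must_weak:
  assumes "involutive dual" and f: "trace_following N T good f"
    and "weak L p s q" "Must dual L T good p (f (map dual s @ u))"
  shows "Must dual L T good q (f u)"
  using assms(3,4)
proof (induction)
  case (weak_refl p)
  then show ?case
    by simp
next
  case (weak_tau p p' s q)
  from weak_tau.prems trace_following_not_good[OF f]
  have "Must dual L T good p' (f (map dual s @ u))"
    by (rule Must_comp_step) (rule comp_step.proc_tau[of L, OF weak_tau.hyps(1)])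
  then show ?case
    by (rule weak_tau.IH)
next
  case (weak_vis p \<mu> p' s q)
  have "L p (Vis (dual (dual \<mu>))) p'"
    using assms(1) weak_vis.hyps by (simp add: involutive_def)
  then have "comp_step dual L T (p, f (map dual (\<mu> # s) @ u)) (p', f (map dual s @ u))"
    using trace_following_Cons[OF f] by (auto intro: comp_step.comm)
  with weak_vis.prems trace_following_not_good[OF f]
  have "Must dual L T good p' (f (map dual s @ u))"
    by (rule Must_comp_step)
  then show ?case
    by (rule weak_vis.IH)
qed

lemma Must_converges_along:
  assumes "involutive dual" and f: "trace_following N T good f"
    and "Must dual L T good p (f (map dual s))"
  shows "converges_along L p s"
  unfolding converges_along_def
proof (intro allI impI)
  fix s' q assume "prefix s' s" "weak L p s' q"
  moreover from this obtain u where "s = s' @ u"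
    by (auto simp: prefix_def)
  ultimately have "Must dual L T good q (f (map dual u))"
    using Must_weak[OF assms(1) f, of L p s' q "map dual u"] assms(3) by simp
  then show "\<not> diverges L q"
    using trace_following_not_good[OF f] by (rule Must_not_diverges)
qed

lemma Must_blocking_Cons:
  assumes f: "trace_following N T good f" and "\<nu> \<notin> N"
    and tau: "\<And>p'. L p Tau p' \<Longrightarrow> Must dual L T good p' (f (\<nu> # s))"
    and vis: "\<And>p'. L p (Vis (dual \<nu>)) p' \<Longrightarrow> Must dual L T good p' (f s)"
  shows "Must dual L T good p (f (\<nu> # s))"
proof (rule Must_stepI)
  have "enabled T (f (\<nu> # s)) Tau"
    using f \<open>\<nu> \<notin> N\<close> by (simp add: trace_following_def)
  then show "\<exists>x. comp_step dual L T (p, f (\<nu> # s)) x"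
    by (auto simp: enabled_def intro: comp_step.test_tau)
next
  fix t' assume "T (f (\<nu> # s)) Tau t'"
  then have "good t'"
    using f \<open>\<nu> \<notin> N\<close> by (simp add: trace_following_def)
  then show "Must dual L T good p t'"
    by (rule Must_good)
next
  fix \<mu> p' t' assume "L p (Vis (dual \<mu>)) p'" "T (f (\<nu> # s)) (Vis \<mu>) t'"
  moreover from this have "if \<mu> = \<nu> then t' = f s else good t'"
    using f \<open>\<nu> \<notin> N\<close> unfolding trace_following_def by auto
  ultimately show "Must dual L T good p' t'"
    using vis by (auto intro: Must_good split: if_splits)
qed (rule tau)

subsection \<open>Exchanging non-blocking actions\<close>

locale nonblocking_testing =
  fixes dual :: "'a \<Rightarrow> 'a" and N :: "'a set"
    and L :: "('p, 'a) lts" and T :: "('t, 'a) lts" and good :: "'t \<Rightarrow> bool"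
  assumes involutive: "involutive dual"
    and N_delay: "N_delay N L"
    and Fwd_Feedback: "Fwd_Feedback dual N L"
    and Boomerang: "Boomerang dual N L"
    and N_confluence: "N_confluence N T"
    and N_determinacy: "N_determinacy N T"
    and N_tau: "N_tau dual N T"
    and good_N_invariant: "good_N_invariant N T good"
begin

lemma dual_dual [simp]: "dual (dual \<mu>) = \<mu>"
  using involutive by (simp add: involutive_def)

lemma comm_feedback:
  assumes "\<eta> \<in> N" and "L p' (Vis \<eta>) p" "T t (Vis \<eta>) t'"
    and "L p (Vis (dual \<eta>)) p1" "T t (Vis \<eta>) t1"
  shows "(p1, t1) = (p', t') \<or> comp_step dual L T (p', t') (p1, t1)"
proof -
  have "t1 = t'"
    using N_determinacy assms unfolding N_determinacy_def by blast
  moreover have "L p' Tau p1 \<or> p' = p1"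
    using Fwd_Feedback assms unfolding Fwd_Feedback_def by blast
  ultimately show ?thesis
    by (auto intro: comp_step.proc_tau)
qed

lemma comp_step_exchange:
  assumes "\<eta> \<in> N" and p: "L p' (Vis \<eta>) p" and t: "T t (Vis \<eta>) t'"
    and "comp_step dual L T (p, t) (p1, t1)"
  shows "(p1, t1) = (p', t') \<or> comp_step dual L T (p', t') (p1, t1) \<or>
    (\<exists>p2 t2. comp_step dual L T (p', t') (p2, t2) \<and> L p2 (Vis \<eta>) p1 \<and> T t1 (Vis \<eta>) t2)"
proof -
  have delay: "\<exists>p2. L p' \<alpha> p2 \<and> L p2 (Vis \<eta>) p1" if "L p \<alpha> p1" for \<alpha>
    using that N_delay \<open>\<eta> \<in> N\<close> p unfolding N_delay_def by blast
  from assms(4) show ?thesis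
  proof cases
    case proc_tau
    then show ?thesis
      using delay t by (blast intro: comp_step.proc_tau)
  next
    case test_tau
    then consider (commute) t2 where "T t' Tau t2" "T t1 (Vis \<eta>) t2"
      | (feedback) "T t' (Vis (dual \<eta>)) t1"
      using N_tau \<open>\<eta> \<in> N\<close> t unfolding N_tau_def by blast
    then show ?thesis
    proof cases
      case commute
      then show ?thesis
        using test_tau p by (blast intro: comp_step.test_tau)
    next
      case feedback
      have "L p' (Vis (dual (dual \<eta>))) p1"
        using p test_tau by simp
      with feedback show ?thesis
        by (blast intro: comp_step.comm)
    qed
  next
    case (comm \<mu>)
    show ?thesis
    proof (cases "\<mu> = \<eta>")
      case True
      then show ?thesis
        using comm_feedback[OF assms(1-3)] comm by blast
    next
      case False
      then obtain t2 where "T t' (Vis \<mu>) t2" "T t1 (Vis \<eta>) t2"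
        using N_confluence \<open>\<eta> \<in> N\<close> t comm unfolding N_confluence_def by blast
      then show ?thesis
        using delay comm by (blast intro: comp_step.comm)
    qed
  qed
qed

lemma Must_exchange:
  assumes "\<eta> \<in> N" and "Must dual L T good p' t'" "L p' (Vis \<eta>) p" "T t (Vis \<eta>) t'"
  shows "Must dual L T good p t"
  using assms(2-4)
proof (induction arbitrary: p t rule: Must_induct)
  case (good p' t')
  then show ?case
    using good_N_invariant \<open>\<eta> \<in> N\<close> by (auto simp: good_N_invariant_def intro: Must_good)
next
  case (step p' t')
  have "\<exists>x. comp_step dual L T (p, t) x"
    using Boomerang \<open>\<eta> \<in> N\<close> step.prems unfolding Boomerang_def by (blast intro: comp_step.comm)
  moreover have "Must dual L T good p1 t1" if "comp_step dual L T (p, t) (p1, t1)" for p1 t1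
    using comp_step_exchange[OF \<open>\<eta> \<in> N\<close> step.prems that] step.hyps step.IH by blast
  ultimately show ?case
    by (subst Must_iff) blast
qed

lemma Must_nonblocking_Cons:
  assumes f: "trace_following N T good f" and "\<nu> \<in> N"
    and vis: "\<And>p'. L p (Vis (dual \<nu>)) p' \<Longrightarrow> Must dual L T good p' (f s)"
  shows "Must dual L T good p (f (\<nu> # s))"
proof -
  obtain p' where "L p (Vis (dual \<nu>)) p'" "L p' (Vis \<nu>) p"
    using Boomerang \<open>\<nu> \<in> N\<close> unfolding Boomerang_def by blast
  then show ?thesis
    using Must_exchange[OF \<open>\<nu> \<in> N\<close> vis] trace_following_Cons[OF f] by blast
qed

lemma Must_trace_following:
  assumes f: "trace_following N T good f"
    and conv: "converges_along L p s"
    and "\<And>q. weak L p s q \<Longrightarrow> \<not> diverges L q \<Longrightarrow> Must dual L T good q (f [])"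
  shows "Must dual L T good p (f (map dual s))"
proof -
  have "Must dual L T good q (f [])" if "weak L p s q" for q
    using that weak_derivative_not_diverges[OF conv that] by (rule assms(3))
  with conv show ?thesis
  proof (induction rule: converges_along_induct)
    case (Nil p)
    then show ?case
      by (simp add: weak_refl)
  next
    case (Cons p \<mu> s)
    have tau: "Must dual L T good p' (f (dual \<mu> # map dual s))" if "L p Tau p'" for p'
      using Cons.IH(1)[OF that] Cons.prems that by (simp add: weak_tau)
    have vis: "Must dual L T good p' (f (map dual s))" if "L p (Vis (dual (dual \<mu>))) p'" for p'
      using Cons.IH(2) Cons.prems that by (simp add: weak_vis)
    have "Must dual L T good p (f (dual \<mu> # map dual s))"
    proof (cases "dual \<mu> \<in> N")
      case True
      then show ?thesis
        using vis by (rule Must_nonblocking_Cons[OF f])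
    next
      case False
      then show ?thesis
        using tau vis by (rule Must_blocking_Cons[OF f])
    qed
    then show ?case
      by simp
  qed
qed

end

subsection \<open>Convergence tests and acceptance tests\<close>

definition convergence_test :: "('t, 'a) lts \<Rightarrow> ('t \<Rightarrow> bool) \<Rightarrow> 't \<Rightarrow> bool" where
  "convergence_test T good t \<longleftrightarrow>
     (\<forall>\<mu>. \<not> enabled T t (Vis \<mu>)) \<and> enabled T t Tau \<and> (\<forall>t'. T t Tau t' \<longrightarrow> good t')"

definition acceptance_test ::
    "'a set \<Rightarrow> ('t, 'a) lts \<Rightarrow> ('t \<Rightarrow> bool) \<Rightarrow> ('a \<Rightarrow> 'y) \<Rightarrow> ('y \<Rightarrow> 'x) \<Rightarrow> 'x set \<Rightarrow> 't \<Rightarrow> bool" where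
  "acceptance_test N T good \<phi> \<delta> E t \<longleftrightarrow>
     \<not> enabled T t Tau \<and>
     (\<forall>\<eta>\<in>N. \<not> enabled T t (Vis \<eta>)) \<and>
     (\<forall>\<beta>\<in>- N. enabled T t (Vis \<beta>) \<longrightarrow> \<delta> (\<phi> \<beta>) \<in> E) \<and>
     (\<forall>e\<in>E. \<exists>\<beta>\<in>- N. e = \<delta> (\<phi> \<beta>) \<and> enabled T t (Vis \<beta>)) \<and>
     (\<forall>\<beta>\<in>- N. \<forall>t'. T t (Vis \<beta>) t' \<longrightarrow> good t')"

definition hitting_set :: "'x set \<Rightarrow> 'x set set \<Rightarrow> bool" where
  "hitting_set E U \<longleftrightarrow> (\<forall>x\<in>U. x \<inter> E \<noteq> {})"

lemma AxCmpl_convergence_test: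
  assumes "AxCmpl N T good X \<phi> \<delta>"
  obtains f where "trace_following N T good f" "convergence_test T good (f [])"
  using assms unfolding AxCmpl_def convergence_test_def by (elim exE conjE) blast

lemma AxCmpl_acceptance_test:
  assumes "AxCmpl N T good X \<phi> \<delta>" "finite E" "E \<subseteq> X"
  obtains f where "trace_following N T good f" "acceptance_test N T good \<phi> \<delta> E (f [])"
proof -
  obtain tacc where "\<forall>E. finite E \<longrightarrow> E \<subseteq> X \<longrightarrow>
      trace_following N T good (\<lambda>s. tacc s E) \<and> acceptance_test N T good \<phi> \<delta> E (tacc [] E)"
    using assms(1) unfolding AxCmpl_def acceptance_test_def
    by (elim exE conjE) (rule that[unfolded acceptance_test_def])
  with assms(2,3) show thesis
    using that[of "\<lambda>s. tacc s E"] by simp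
qed

lemma Must_convergence_test:
  assumes "\<not> diverges L p" "convergence_test T good t"
  shows "Must dual L T good p t"
  using assms(1)
proof (rule Must_all_steps_good)
  show "good t'" if "T t \<alpha> t'" for \<alpha> t'
    using that assms(2) by (cases \<alpha>) (auto simp: convergence_test_def enabled_def)
  show "\<exists>x. comp_step dual L T (q, t) x" for q
    using assms(2) by (auto simp: convergence_test_def enabled_def intro: comp_step.test_tau)
qed

lemma comp_step_if_same_abstraction:
  assumes "abstracts dual N \<phi> \<delta> L T" "\<delta> (\<phi> \<beta>) = \<delta> (\<phi> \<beta>')"
    and "\<beta> \<in> coR dual N L p" "\<beta>' \<in> ready T t" "\<beta>' \<notin> N"
  shows "\<exists>x. comp_step dual L T (p, t) x"
proof -
  have "\<beta> \<notin> N"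
    using assms(3) by (simp add: coR_def)
  then have "\<phi> \<beta>' \<in> \<phi> ` coR dual N L p"
    using assms unfolding abstracts_def by blast
  then obtain \<beta>'' where \<beta>'': "\<beta>'' \<in> coR dual N L p" "\<phi> \<beta>' = \<phi> \<beta>''"
    by blast
  then have "\<beta>'' \<in> ready T t"
    using assms unfolding abstracts_def coR_def by blast
  with \<beta>''(1) show ?thesis
    unfolding coR_def ready_def enabled_def by (blast intro: comp_step.comm)
qed

lemma comp_step_acceptance_test_iff:
  assumes "abstracts dual N \<phi> \<delta> L T" and t: "acceptance_test N T good \<phi> \<delta> E t"
    and "\<not> enabled L p Tau"
  shows "(\<exists>x. comp_step dual L T (p, t) x) \<longleftrightarrow> coR_abs dual N L \<phi> \<delta> p \<inter> E \<noteq> {}"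
proof
  assume "\<exists>x. comp_step dual L T (p, t) x"
  then obtain x where "comp_step dual L T (p, t) x"
    by blast
  then obtain \<beta> where "enabled L p (Vis (dual \<beta>))" "enabled T t (Vis \<beta>)"
    using t assms(3) by cases (auto simp: acceptance_test_def enabled_def)
  moreover from this have "\<beta> \<notin> N" "\<delta> (\<phi> \<beta>) \<in> E"
    using t by (auto simp: acceptance_test_def)
  ultimately show "coR_abs dual N L \<phi> \<delta> p \<inter> E \<noteq> {}"
    by (auto simp: coR_abs_def coR_def)
next
  assume "coR_abs dual N L \<phi> \<delta> p \<inter> E \<noteq> {}"
  then obtain \<beta> where "\<beta> \<in> coR dual N L p" "\<delta> (\<phi> \<beta>) \<in> E"
    by (auto simp: coR_abs_def)
  moreover from this obtain \<beta>' where "\<delta> (\<phi> \<beta>) = \<delta> (\<phi> \<beta>')" "\<beta>' \<in> ready T t" "\<beta>' \<notin> N"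
    using t by (auto simp: acceptance_test_def ready_def)
  ultimately show "\<exists>x. comp_step dual L T (p, t) x"
    using comp_step_if_same_abstraction[OF assms(1)] by blast
qed

lemma Must_acceptance_test:
  assumes "abstracts dual N \<phi> \<delta> L T" and t: "acceptance_test N T good \<phi> \<delta> E t"
    and "\<not> diverges L p" "hitting_set E (acc_sets dual N L \<phi> \<delta> p [])"
  shows "Must dual L T good p t"
  using assms(3)
proof (rule Must_all_steps_good)
  show "good t'" if "T t \<alpha> t'" for \<alpha> t'
    using that t by (cases \<alpha>) (auto simp: acceptance_test_def enabled_def)
  show "\<exists>x. comp_step dual L T (q, t) x" if "q \<in> ws L p []" for q
    using that assms(4) comp_step_acceptance_test_iff[OF assms(1) t]
    by (auto simp: hitting_set_def acc_sets_def ws_def)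
qed

lemma acc_leI_hitting_sets:
  assumes "finite U" "\<And>x. x \<in> U \<Longrightarrow> finite x"
    and "\<And>E. finite E \<Longrightarrow> E \<subseteq> \<Union>U \<Longrightarrow> hitting_set E U \<Longrightarrow> hitting_set E V"
  shows "acc_le U V"
  unfolding acc_le_def
proof (rule ballI, rule ccontr)
  fix x assume "x \<in> V" and none: "\<not> (\<exists>y\<in>U. y \<subseteq> x)"
  define E where "E = \<Union>U - x"
  have "finite E" "E \<subseteq> \<Union>U"
    using assms(1,2) by (auto simp: E_def)
  moreover have "hitting_set E U"
    using none unfolding hitting_set_def E_def by blast
  ultimately have "hitting_set E V"
    by (rule assms(3))
  with \<open>x \<in> V\<close> show False
    unfolding hitting_set_def E_def by blast
qed

lemma finite_acc_sets:
  assumes "finite_image R" "converges_along R p s"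
  shows "finite (acc_sets dual N R \<phi> \<delta> p s)"
proof -
  have "ws R p s \<subseteq> {q. weak R p s q}"
    by (auto simp: ws_def)
  then show ?thesis
    using finite_weak_derivatives[OF assms] by (auto simp: acc_sets_def intro: finite_subset)
qed

lemma Union_acc_sets_subset:
  assumes "label_abstraction N Y X \<phi> \<delta>"
  shows "\<Union>(acc_sets dual N R \<phi> \<delta> p s) \<subseteq> X"
  using assms by (auto simp: acc_sets_def coR_abs_def coR_def label_abstraction_def)

context nonblocking_testing
begin

lemma Must_convergence_test_iff:
  assumes f: "trace_following N T good f" and "convergence_test T good (f [])"
  shows "Must dual L T good p (f (map dual s)) \<longleftrightarrow> converges_along L p s"
proof
  show "converges_along L p s" if "Must dual L T good p (f (map dual s))"
    using that by (rule Must_converges_along[OF involutive f])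
  show "Must dual L T good p (f (map dual s))" if "converges_along L p s"
    using f that by (rule Must_trace_following) (rule Must_convergence_test[OF _ assms(2)])
qed

lemma Must_acceptance_test_iff:
  assumes f: "trace_following N T good f" and nil: "acceptance_test N T good \<phi> \<delta> E (f [])"
    and abs: "abstracts dual N \<phi> \<delta> L T" and conv: "converges_along L p s"
  shows "Must dual L T good p (f (map dual s)) \<longleftrightarrow> hitting_set E (acc_sets dual N L \<phi> \<delta> p s)"
proof
  assume must: "Must dual L T good p (f (map dual s))"
  have "coR_abs dual N L \<phi> \<delta> q \<inter> E \<noteq> {}" if q: "q \<in> ws L p s" for q
  proof -
    have "Must dual L T good q (f [])"
      using Must_weak[OF involutive f, of L p s q "[]"] must q by (simp add: ws_def)
    then have "\<exists>x. comp_step dual L T (q, f []) x"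
      using trace_following_not_good[OF f] by (rule Must_not_stuck)
    then show ?thesis
      using comp_step_acceptance_test_iff[OF abs nil] q by (simp add: ws_def)
  qed
  then show "hitting_set E (acc_sets dual N L \<phi> \<delta> p s)"
    by (simp add: hitting_set_def acc_sets_def)
next
  assume hits: "hitting_set E (acc_sets dual N L \<phi> \<delta> p s)"
  show "Must dual L T good p (f (map dual s))"
    using f conv
  proof (rule Must_trace_following)
    fix q assume q: "weak L p s q" "\<not> diverges L q"
    have "hitting_set E (acc_sets dual N L \<phi> \<delta> q [])"
      using hits ws_append[OF q(1), of "[]"] by (auto simp: hitting_set_def acc_sets_def)
    with q(2) show "Must dual L T good q (f [])"
      by (rule Must_acceptance_test[OF abs nil])
  qed
qed

lemma must_preorder_converges_along:
  assumes "AxCmpl N T good X \<phi> \<delta>"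
    and pre: "must_preorder dual L T good p q" and conv: "converges_along L p s"
  shows "converges_along L q s"
proof -
  obtain f where "trace_following N T good f" "convergence_test T good (f [])"
    using assms(1) by (rule AxCmpl_convergence_test)
  note Must_iff_converges_along = Must_convergence_test_iff[OF this]
  show ?thesis
    using pre conv unfolding must_preorder_def Must_iff_converges_along[symmetric] by blast
qed

lemma must_preorder_hitting_set:
  assumes ax: "AxCmpl N T good X \<phi> \<delta>" and abs: "abstracts dual N \<phi> \<delta> L T"
    and pre: "must_preorder dual L T good p q" and conv: "converges_along L p s"
    and E: "finite E" "E \<subseteq> X"
    and hits: "hitting_set E (acc_sets dual N L \<phi> \<delta> p s)"
  shows "hitting_set E (acc_sets dual N L \<phi> \<delta> q s)"
proof -
  obtain f where "trace_following N T good f" "acceptance_test N T good \<phi> \<delta> E (f [])"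
    using ax E by (rule AxCmpl_acceptance_test)
  note Must_iff_hitting_set = Must_acceptance_test_iff[OF this abs]
  have "Must dual L T good q (f (map dual s))"
    using pre hits Must_iff_hitting_set[OF conv] by (simp add: must_preorder_def)
  then show ?thesis
    using Must_iff_hitting_set[OF must_preorder_converges_along[OF ax pre conv]] by simp
qed

end

theorem proposition25:
  fixes dual :: "'a::countable \<Rightarrow> 'a"
    and N :: "'a set"
    and L :: "('p, 'a) lts"
    and T :: "('t, 'a) lts"
    and good :: "'t \<Rightarrow> bool"
    and Y :: "'y set" and X :: "'x set"
    and \<phi> :: "'a \<Rightarrow> 'y" and \<delta> :: "'y \<Rightarrow> 'x"
    and p q :: 'p
  assumes "involutive dual"
    and "finite_image L" and "finite_image T"
    and "in_M dual N L" and "in_A dual N T"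
    and "good_N_invariant N T good"
    and "label_abstraction N Y X \<phi> \<delta>"
    and "abstracts dual N \<phi> \<delta> L T"
    and "AxCmpl N T good X \<phi> \<delta>"
    and "finitary dual N L \<phi> \<delta>"
    and "must_preorder dual L T good p q"
  shows "abs_preorder dual N L \<phi> \<delta> p q"
proof -
  interpret nonblocking_testing dual N L T good
    using assms(1,4-6) by unfold_locales (auto simp: in_M_def in_A_def)
  have "acc_le (acc_sets dual N L \<phi> \<delta> p s) (acc_sets dual N L \<phi> \<delta> q s)"
    if s: "converges_along L p s" for s
  proof (rule acc_leI_hitting_sets)
    show "finite (acc_sets dual N L \<phi> \<delta> p s)"
      using assms(2) s by (rule finite_acc_sets)
    show "finite x" if "x \<in> acc_sets dual N L \<phi> \<delta> p s" for x
      using that assms(10) by (auto simp: acc_sets_def finitary_def)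
    show "hitting_set E (acc_sets dual N L \<phi> \<delta> q s)"
      if "finite E" "E \<subseteq> \<Union>(acc_sets dual N L \<phi> \<delta> p s)"
        "hitting_set E (acc_sets dual N L \<phi> \<delta> p s)" for E
      using that(1) order.trans[OF that(2) Union_acc_sets_subset[OF assms(7)]] that(3)
      by (rule must_preorder_hitting_set[OF assms(9,8,11) s])
  qed
  then show ?thesis
    using must_preorder_converges_along[OF assms(9,11)] by (simp add: abs_preorder_def)
qed

end
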